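(* Let $a,b,c,d\in\mathbb R$. For $0\le s\le t$ put $\hat t=t-s$ and let $\mathcal M^{[s,t]}=(c_{ijk}^{[s,t]})_{i,j,k=1}^2$ be the cubic matrix with entries \[c_{111}^{[s,t]}=a\cos\hat t-b\sin\hat t,\qquad c_{112}^{[s,t]}=b\cos\hat t+a\sin\hat t,\] \[c_{121}^{[s,t]}=(1-a)\cos\hat t+b\sin\hat t,\qquad c_{122}^{[s,t]}=-b\cos\hat t+(1-a)\sin\hat t,\] \[c_{211}^{[s,t]}=c\cos\hat t-d\sin\hat t,\qquad c_{212}^{[s,t]}=d\cos\hat t+c\sin\hat t,\] \[c_{221}^{[s,t]}=-c\cos\hat t-(1-d)\sin\hat t,\qquad c_{222}^{[s,t]}=(1-d)\cos\hat t-c\sin\hat t.\] Then $\{\mathcal M^{[s,t]}\}$ generates a homogeneous, periodic flow of algebras of type (D).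
   Context: A cubic matrix of size $m$ is a real array $A=(a_{ijk})_{i,j,k=1}^m$. Multiplication of type (D): for cubic matrices $A=(a_{ijk})$, $B=(b_{ijk})$, the product $C=AB=(c_{ijr})$ has entries $c_{ijr}=\sum_{k,n=1}^m a_{ijk}b_{knr}$. A family $\{\mathcal A^{[s,t]}: 0\le s\le t\}$ of $m$-dimensional real algebras with basis $e_1,\dots,e_m$ and multiplication $e_ie_j=\sum_{k} c_{ijk}^{[s,t]}e_k$ is a flow of algebras (FA) of type (D) if the cubic matrices $\mathcal M^{[s,t]}=(c_{ijk}^{[s,t]})$ satisfy the Kolmogorov-Chapman equation $\mathcal M^{[s,t]}=\mathcal M^{[s,\tau]}\mathcal M^{[\tau,t]}$ for all $0\le s<\tau<t$ with respect to the multiplication of type (D). A family of cubic matrices generates an FA if the algebras having these matrices as structural constants form an FA. An FA is (time) homogeneous if $\mathcal M^{[s,t]}$ depends only on $t-s$. An FA is periodic if $\mathcal M^{[s,t]}$ is periodic with respect to at least one of the variables $s,t$; periodicity with respect to $t$ means that there is a nonzero constant $P$ (the period) with $\mathcal M^{[s,t+P]}=\mathcal M^{[s,t]}$ for all values of $t$. *)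

theory Defs
  imports "HOL-Analysis.Analysis"
begin

(* The size m of a cubic matrix is the cardinality of the index type; for size 2 the
   index type is 2, whose two elements are written 1 and 2. *)
type_synonym 'm cubic_matrix = "real ^ 'm ^ 'm ^ 'm"

definition mult_D :: "'m::finite cubic_matrix \<Rightarrow> 'm cubic_matrix \<Rightarrow> 'm cubic_matrix" where
  "mult_D A B = (\<chi> i j r. \<Sum>k\<in>UNIV. \<Sum>n\<in>UNIV. A $ i $ j $ k * B $ k $ n $ r)"

(* An m-dimensional real algebra with a fixed basis is represented by its multiplication
   on real ^ 'm, the basis e_i being axis i 1; no associativity, commutativity or unit
   is assumed. *)
type_synonym 'm algebra_mult = "real ^ 'm \<Rightarrow> real ^ 'm \<Rightarrow> real ^ 'm"

definition structure_matrix :: "'m::finite algebra_mult \<Rightarrow> 'm cubic_matrix" where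
  "structure_matrix f = (\<chi> i j k. f (axis i 1) (axis j 1) $ k)"

definition algebra_of :: "'m::finite cubic_matrix \<Rightarrow> 'm algebra_mult" where
  "algebra_of C x y = (\<chi> k. \<Sum>i\<in>UNIV. \<Sum>j\<in>UNIV. x $ i * y $ j * C $ i $ j $ k)"

lemma bilinear_algebra_of: "bilinear (algebra_of C)"
  unfolding bilinear_def algebra_of_def
  by (intro conjI allI linearI)
    (simp_all add: vec_eq_iff distrib_right distrib_left sum.distrib sum_distrib_left mult_ac)

lemma structure_matrix_algebra_of: "structure_matrix (algebra_of C) = C"
proof -
  have "axis i (1::real) $ p * axis j 1 $ q * C $ p $ q $ k
      = (if q = j then if p = i then C $ p $ q $ k else 0 else 0)" for i j k p q
    by (simp add: axis_def)
  then show ?thesis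
    by (simp add: structure_matrix_def algebra_of_def vec_eq_iff)
qed

(* Families are total functions of s and t; only their values for 0 \<le> s \<le> t are
   meaningful, and every predicate below looks at these values only. *)
type_synonym 'm algebra_family = "real \<Rightarrow> real \<Rightarrow> 'm algebra_mult"

definition flow_of_algebras_D :: "'m::finite algebra_family \<Rightarrow> bool" where
  "flow_of_algebras_D F \<longleftrightarrow>
     (\<forall>s t. 0 \<le> s \<and> s \<le> t \<longrightarrow> bilinear (F s t)) \<and>
     (\<forall>s \<tau> t. 0 \<le> s \<and> s < \<tau> \<and> \<tau> < t \<longrightarrow>
        structure_matrix (F s t) =
          mult_D (structure_matrix (F s \<tau>)) (structure_matrix (F \<tau> t)))"

definition homogeneous_family :: "'m::finite algebra_family \<Rightarrow> bool" where
  "homogeneous_family F \<longleftrightarrow>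
     (\<exists>N. \<forall>s t. 0 \<le> s \<and> s \<le> t \<longrightarrow> structure_matrix (F s t) = N (t - s))"

(* The period does not depend on the other variable: otherwise any period longer than t
   would vacuously make every family periodic in s. *)
definition periodic_in_s :: "'m::finite algebra_family \<Rightarrow> bool" where
  "periodic_in_s F \<longleftrightarrow>
     (\<exists>P. P \<noteq> 0 \<and>
        (\<forall>s t. 0 \<le> s \<and> s \<le> t \<and> 0 \<le> s + P \<and> s + P \<le> t \<longrightarrow>
           structure_matrix (F (s + P) t) = structure_matrix (F s t)))"

definition periodic_in_t :: "'m::finite algebra_family \<Rightarrow> bool" where
  "periodic_in_t F \<longleftrightarrow>
     (\<exists>P. P \<noteq> 0 \<and>
        (\<forall>s t. 0 \<le> s \<and> s \<le> t \<and> s \<le> t + P \<longrightarrow>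
           structure_matrix (F s (t + P)) = structure_matrix (F s t)))"

definition periodic_family :: "'m::finite algebra_family \<Rightarrow> bool" where
  "periodic_family F \<longleftrightarrow> periodic_in_s F \<or> periodic_in_t F"

definition generated_family ::
    "(real \<Rightarrow> real \<Rightarrow> 'm::finite cubic_matrix) \<Rightarrow> 'm algebra_family" where
  "generated_family M s t = algebra_of (M s t)"

end

theory Submission
  imports Defs
begin

text \<open>
  Multiplication of type (D) sees its right factor \<open>B\<close> only through the square matrix
  whose \<open>k\<close>-th row is \<open>\<Sum>\<^sub>n B $ k $ n\<close>, and this matrix acts on the rows \<open>A $ i $ j\<close> of the
  left factor (\<open>mult_D_row\<close>). Hence a cubic matrix \<open>C\<close> whose own fibre sum is the identity
  turns the type (D) product into the ordinary matrix product: letting square matrices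
  \<open>R\<close> and \<open>S\<close> act on the rows of \<open>C\<close> and multiplying the results gives the action of \<open>R ** S\<close>
  on \<open>C\<close> (\<open>mult_D_act_rows\<close>). Every one-parameter semigroup of square matrices thus yields
  a homogeneous solution of the Kolmogorov-Chapman equation.

  The given family is of this form. At \<open>s = t\<close> its rows are \<open>(a, b)\<close>, \<open>(1 - a, - b)\<close>,
  \<open>(c, d)\<close>, \<open>(- c, 1 - d)\<close>; the first two add up to \<open>(1, 0)\<close> and the last two to \<open>(0, 1)\<close>,
  so the fibre sum is the identity whatever \<open>a, b, c, d\<close> are. At general \<open>s \<le> t\<close> these rows
  are rotated by the angle \<open>t - s\<close>. The addition formulas for sine and cosine make the
  rotations a one-parameter semigroup, and they are periodic with period \<open>2 * pi\<close>.
\<close>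

definition fibre_sum :: "'m::finite cubic_matrix \<Rightarrow> real ^ 'm ^ 'm" where
  "fibre_sum B = (\<chi> k. \<Sum>n\<in>UNIV. B $ k $ n)"

definition act_rows :: "'m::finite cubic_matrix \<Rightarrow> real ^ 'm ^ 'm \<Rightarrow> 'm cubic_matrix" where
  "act_rows C R = (\<chi> i j. C $ i $ j v* R)"

lemma mult_D_row: "mult_D A B $ i $ j = A $ i $ j v* fibre_sum B"
  by (simp add: mult_D_def fibre_sum_def vector_matrix_mult_def vec_eq_iff
      sum_distrib_left mult.commute)

lemma fibre_sum_act_rows: "fibre_sum (act_rows C R) = fibre_sum C ** R"
proof -
  have "(\<Sum>n\<in>UNIV. \<Sum>i\<in>UNIV. R $ i $ r * C $ k $ n $ i)
      = (\<Sum>i\<in>UNIV. \<Sum>n\<in>UNIV. R $ i $ r * C $ k $ n $ i)" for k r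
    by (rule sum.swap)
  then show ?thesis
    by (simp add: fibre_sum_def act_rows_def vector_matrix_mult_def matrix_matrix_mult_def
        vec_eq_iff sum_distrib_left mult.commute)
qed

text \<open>
  The right factor acts through its fibre sum, which is \<open>mat 1 ** S\<close>; the rows of the left
  factor, already moved by \<open>R\<close>, are therefore moved on by \<open>S\<close>.
\<close>
lemma mult_D_act_rows:
  assumes "fibre_sum C = mat 1"
  shows "mult_D (act_rows C R) (act_rows C S) = act_rows C (R ** S)"
proof -
  have "mult_D (act_rows C R) (act_rows C S) $ i $ j = C $ i $ j v* (R ** S)" for i j
    by (simp add: mult_D_row fibre_sum_act_rows assms)
      (simp add: act_rows_def vector_matrix_mul_assoc)
  then show ?thesis
    by (simp add: act_rows_def vec_eq_iff)
qed

lemma flow_of_algebras_D_act_rows: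
  assumes "fibre_sum C = mat 1"
    and "\<And>u v. 0 < u \<Longrightarrow> 0 < v \<Longrightarrow> R (u + v) = R u ** R v"
    and M: "\<And>s t. 0 \<le> s \<Longrightarrow> s \<le> t \<Longrightarrow> M s t = act_rows C (R (t - s))"
  shows "flow_of_algebras_D (generated_family M)"
  unfolding flow_of_algebras_D_def generated_family_def structure_matrix_algebra_of
proof (intro conjI allI impI)
  fix s \<tau> t :: real
  assume st: "0 \<le> s \<and> s < \<tau> \<and> \<tau> < t"
  have "R (t - s) = R (\<tau> - s) ** R (t - \<tau>)"
    using assms(2)[of "\<tau> - s" "t - \<tau>"] st by simp
  then show "M s t = mult_D (M s \<tau>) (M \<tau> t)"
    using st by (simp add: M mult_D_act_rows[OF assms(1)])
qed (rule bilinear_algebra_of)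

lemma homogeneous_family_generated_family:
  assumes "\<And>s t. 0 \<le> s \<Longrightarrow> s \<le> t \<Longrightarrow> M s t = N (t - s)"
  shows "homogeneous_family (generated_family M)"
  unfolding homogeneous_family_def generated_family_def structure_matrix_algebra_of
  using assms by blast

lemma periodic_family_generated_family:
  assumes "P \<noteq> 0" and "\<And>u. N (u + P) = N u"
    and M: "\<And>s t. 0 \<le> s \<Longrightarrow> s \<le> t \<Longrightarrow> M s t = N (t - s)"
  shows "periodic_family (generated_family M)"
proof -
  have "M s (t + P) = M s t" if "0 \<le> s \<and> s \<le> t \<and> s \<le> t + P" for s t
    using that M[of s t] M[of s "t + P"] assms(2)[of "t - s"] by (simp add: algebra_simps)
  with assms(1) show ?thesis
    unfolding periodic_family_def periodic_in_t_def generated_family_def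
      structure_matrix_algebra_of
    by blast
qed

text \<open>
  The transpose of the usual counterclockwise rotation matrix, because it multiplies row
  vectors from the right.
\<close>
definition rotation :: "real \<Rightarrow> real ^ 2 ^ 2" where
  "rotation u = vector [vector [cos u, sin u], vector [- sin u, cos u]]"

lemma rotation_add: "rotation (u + v) = rotation u ** rotation v"
  by (simp add: rotation_def matrix_matrix_mult_def vec_eq_iff forall_2 sum_2
      cos_add sin_add)

lemma rotation_periodic: "rotation (u + 2 * pi) = rotation u"
  by (simp add: rotation_def)

definition initial_matrix :: "real \<Rightarrow> real \<Rightarrow> real \<Rightarrow> real \<Rightarrow> 2 cubic_matrix" where
  "initial_matrix a b c d =
     vector [vector [vector [a, b], vector [1 - a, - b]],
             vector [vector [c, d], vector [- c, 1 - d]]]"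

lemma fibre_sum_initial_matrix: "fibre_sum (initial_matrix a b c d) = mat 1"
  by (simp add: fibre_sum_def initial_matrix_def mat_def vec_eq_iff forall_2 sum_2)

theorem proposition5:
  fixes a b c d :: real
    and M :: "real \<Rightarrow> real \<Rightarrow> 2 cubic_matrix"
  assumes "\<And>s t. 0 \<le> s \<Longrightarrow> s \<le> t \<Longrightarrow> M s t $ 1 $ 1 $ 1 = a * cos (t - s) - b * sin (t - s)"
    and "\<And>s t. 0 \<le> s \<Longrightarrow> s \<le> t \<Longrightarrow> M s t $ 1 $ 1 $ 2 = b * cos (t - s) + a * sin (t - s)"
    and "\<And>s t. 0 \<le> s \<Longrightarrow> s \<le> t \<Longrightarrow> M s t $ 1 $ 2 $ 1 = (1 - a) * cos (t - s) + b * sin (t - s)"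
    and "\<And>s t. 0 \<le> s \<Longrightarrow> s \<le> t \<Longrightarrow> M s t $ 1 $ 2 $ 2 = - b * cos (t - s) + (1 - a) * sin (t - s)"
    and "\<And>s t. 0 \<le> s \<Longrightarrow> s \<le> t \<Longrightarrow> M s t $ 2 $ 1 $ 1 = c * cos (t - s) - d * sin (t - s)"
    and "\<And>s t. 0 \<le> s \<Longrightarrow> s \<le> t \<Longrightarrow> M s t $ 2 $ 1 $ 2 = d * cos (t - s) + c * sin (t - s)"
    and "\<And>s t. 0 \<le> s \<Longrightarrow> s \<le> t \<Longrightarrow> M s t $ 2 $ 2 $ 1 = - c * cos (t - s) - (1 - d) * sin (t - s)"
    and "\<And>s t. 0 \<le> s \<Longrightarrow> s \<le> t \<Longrightarrow> M s t $ 2 $ 2 $ 2 = (1 - d) * cos (t - s) - c * sin (t - s)"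
  shows "flow_of_algebras_D (generated_family M) \<and>
         homogeneous_family (generated_family M) \<and>
         periodic_family (generated_family M)"
proof -
  have M: "M s t = act_rows (initial_matrix a b c d) (rotation (t - s))"
    if "0 \<le> s" "s \<le> t" for s t
    using that
    by (simp add: vec_eq_iff forall_2 act_rows_def initial_matrix_def rotation_def
        vector_matrix_mult_def sum_2 assms algebra_simps)
  show ?thesis
  proof (intro conjI)
    show "flow_of_algebras_D (generated_family M)"
      using fibre_sum_initial_matrix rotation_add M by (rule flow_of_algebras_D_act_rows)
    show "homogeneous_family (generated_family M)"
      using M by (rule homogeneous_family_generated_family)
    show "periodic_family (generated_family M)"
      by (rule periodic_family_generated_family[where P = "2 * pi"
            and N = "\<lambda>u. act_rows (initial_matrix a b c d) (rotation u)"])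
        (simp_all add: rotation_periodic M)
  qed
qed

end
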